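(* Let $\mu\in\mathbb{R}$, $\beta>0$, $\kappa>0$, and let $X\sim\mathcal{ALSM}(\mu,\beta,\kappa,\boldsymbol{\theta})$ be an asymmetric Laplace scale mixture random variable with mixing probability density (or mass) function $h(\cdot;\boldsymbol{\theta})$ supported in $S_h\subseteq(0,\infty)$. Let $Y\sim\mathcal{AL}(0,1,\kappa)$ and let $W$ be a random variable with probability density (or mass) function $h(\cdot;\boldsymbol{\theta})$, independent of $Y$. Then $$X\stackrel{d}{=}\mu+\beta\,\frac{Y}{W},$$ where $\stackrel{d}{=}$ denotes equality in distribution.
   Context: For $\mu\in\mathbb{R}$, $\beta>0$, $\kappa>0$, the asymmetric Laplace distribution $\mathcal{AL}(\mu,\beta,\kappa)$ is the distribution on $\mathbb{R}$ with density $$f_{\mathrm{AL}}(x;\mu,\beta,\kappa)=\frac{1}{\beta}\,\frac{\kappa}{1+\kappa^2}\begin{cases} e^{-\frac{\kappa}{\beta}(x-\mu)}, & x\ge\mu,\\ e^{-\frac{1}{\kappa\beta}(\mu-x)}, & x<\mu.\end{cases}$$ The function $h(\cdot;\boldsymbol{\theta})$ is a probability density function (with respect to Lebesgue measure) or a probability mass function, depending on a parameter vector $\boldsymbol{\theta}$, whose support $S_h$ is contained in $(0,\infty)$. A real random variable $X$ has the asymmetric Laplace scale mixture distribution $\mathcal{ALSM}(\mu,\beta,\kappa,\boldsymbol{\theta})$ if it has probability density function $$f_{\mathrm{ALSM}}(x;\mu,\beta,\kappa,\boldsymbol{\theta})=\int_{S_h} f_{\mathrm{AL}}(x;\mu,\beta/w,\kappa)\,h(w;\boldsymbol{\theta})\,dw,\qquad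 x\in\mathbb{R},$$ where in the discrete case the integral over $S_h$ is read as the sum $\sum_{w\in S_h}$. *)

theory Defs
  imports "HOL-Probability.Probability"
begin

definition al_pdf :: "real \<Rightarrow> real \<Rightarrow> real \<Rightarrow> real \<Rightarrow> real" where
  "al_pdf \<mu> \<beta> \<kappa> x =
     1 / \<beta> * (\<kappa> / (1 + \<kappa>\<^sup>2)) *
       (if x \<ge> \<mu> then exp (- (\<kappa> / \<beta>) * (x - \<mu>)) else exp (- (1 / (\<kappa> * \<beta>)) * (\<mu> - x)))"

datatype mixing_kind = Continuous | Discrete

definition mixing_support :: "(real \<Rightarrow> real) \<Rightarrow> real set" where
  "mixing_support g = {w. g w \<noteq> 0}"

text \<open>A \<open>Continuous\<close> mixing function is a density with respect to Lebesgue measure, a \<open>Discrete\<close>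
  one a mass function. Summability over all reals forces the support of the latter to be
  countable.\<close>

fun mixing_fun :: "mixing_kind \<Rightarrow> (real \<Rightarrow> real) \<Rightarrow> bool" where
  "mixing_fun Continuous g \<longleftrightarrow>
     g \<in> borel_measurable borel \<and> (\<forall>w. 0 \<le> g w) \<and> (\<integral>\<^sup>+ w. ennreal (g w) \<partial>lborel) = 1"
| "mixing_fun Discrete g \<longleftrightarrow> (\<forall>w. 0 \<le> g w) \<and> (g has_sum 1) UNIV"

text \<open>\<open>has_mixing_law k N W g\<close>: the random variable \<open>W\<close> has density (or mass function) \<open>g\<close>.\<close>

fun has_mixing_law :: "mixing_kind \<Rightarrow> 'a measure \<Rightarrow> ('a \<Rightarrow> real) \<Rightarrow> (real \<Rightarrow> real) \<Rightarrow> bool" where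
  "has_mixing_law Continuous N W g \<longleftrightarrow> distributed N lborel W (\<lambda>w. ennreal (g w))"
| "has_mixing_law Discrete N W g \<longleftrightarrow>
     W \<in> borel_measurable N \<and> (\<forall>w. measure N {\<omega> \<in> space N. W \<omega> = w} = g w)"

text \<open>The density takes extended values because the integral is infinite at \<open>x = \<mu>\<close> when the mixing
  distribution has infinite mean.\<close>

fun alsm_pdf ::
    "mixing_kind \<Rightarrow> ('p \<Rightarrow> real \<Rightarrow> real) \<Rightarrow> real \<Rightarrow> real \<Rightarrow> real \<Rightarrow> 'p \<Rightarrow> real \<Rightarrow> ennreal" where
  "alsm_pdf Continuous h \<mu> \<beta> \<kappa> \<theta> x =
     (\<integral>\<^sup>+ w \<in> mixing_support (h \<theta>). ennreal (al_pdf \<mu> (\<beta> / w) \<kappa> x * h \<theta> w) \<partial>lborel)"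
| "alsm_pdf Discrete h \<mu> \<beta> \<kappa> \<theta> x =
     (\<Sum>\<^sub>\<infinity> w \<in> mixing_support (h \<theta>). ennreal (al_pdf \<mu> (\<beta> / w) \<kappa> x * h \<theta> w))"

end

theory Submission
  imports Defs
begin

text \<open>Since \<open>\<mu> + c Y\<close> has density \<open>al_pdf \<mu> c \<kappa>\<close> for every \<open>c > 0\<close>, conditioning on \<open>W = w\<close>
  turns \<open>\<mu> + \<beta> Y / W\<close> into a variable with density \<open>al_pdf \<mu> (\<beta> / w) \<kappa>\<close>, and Tonelli's
  theorem identifies the mixture of these densities. Both kinds of mixing law are of the form
  \<open>density K g\<close> for a sigma-finite measure \<open>K\<close>: Lebesgue measure, or the counting measure on the
  support of \<open>g\<close>.\<close>

lemma al_pdf_nonneg: "\<beta> \<ge> 0 \<Longrightarrow> \<kappa> \<ge> 0 \<Longrightarrow> al_pdf \<mu> \<beta> \<kappa> x \<ge> 0"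
  by (auto simp: al_pdf_def)

lemma measurable_al_pdf [measurable (raw)]:
  assumes [measurable]: "m \<in> borel_measurable K" "b \<in> borel_measurable K" "c \<in> borel_measurable K"
    "f \<in> borel_measurable K"
  shows "(\<lambda>z. al_pdf (m z) (b z) (c z) (f z)) \<in> borel_measurable K"
  unfolding al_pdf_def by measurable

lemma al_pdf_standardize:
  assumes "c > 0"
  shows "al_pdf 0 1 \<kappa> y = c * al_pdf \<mu> c \<kappa> (\<mu> + c * y)"
  using assms by (auto simp: al_pdf_def zero_le_mult_iff)

lemma nn_integral_al_pdf_affine:
  assumes [measurable]: "\<phi> \<in> borel_measurable borel" and "c > 0"
  shows "(\<integral>\<^sup>+ y. ennreal (al_pdf 0 1 \<kappa> y) * \<phi> (\<mu> + c * y) \<partial>lborel) =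
    (\<integral>\<^sup>+ x. ennreal (al_pdf \<mu> c \<kappa> x) * \<phi> x \<partial>lborel)"
proof -
  have "(\<integral>\<^sup>+ x. ennreal (al_pdf \<mu> c \<kappa> x) * \<phi> x \<partial>lborel) =
      ennreal c * (\<integral>\<^sup>+ y. ennreal (al_pdf \<mu> c \<kappa> (\<mu> + c * y)) * \<phi> (\<mu> + c * y) \<partial>lborel)"
    using \<open>c > 0\<close> by (subst nn_integral_real_affine[where c = c and t = \<mu>]) auto
  also have "\<dots> = (\<integral>\<^sup>+ y. ennreal (al_pdf 0 1 \<kappa> y) * \<phi> (\<mu> + c * y) \<partial>lborel)"
    using \<open>c > 0\<close>
    by (subst nn_integral_cmult[symmetric])
       (auto simp: al_pdf_standardize[OF \<open>c > 0\<close>, of \<kappa> _ \<mu>] ennreal_mult' mult.assoc)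
  finally show ?thesis ..
qed

lemma nn_integral_count_space_eq_infsum:
  fixes f :: "'a \<Rightarrow> ennreal"
  assumes "countable A"
  shows "(\<integral>\<^sup>+ x. f x \<partial>count_space A) = infsum f A"
proof (cases "A = {}")
  case False
  have infsum: "infsum f A = (SUP F\<in>{F. finite F \<and> F \<subseteq> A}. sum f F)"
    by (rule nonneg_infsum_complete) simp
  have fin: "(\<integral>\<^sup>+ x. f x * indicator F x \<partial>count_space A) = sum f F" if "finite F" "F \<subseteq> A" for F
  proof -
    have "(\<integral>\<^sup>+ x. f x * indicator F x \<partial>count_space A) = (\<integral>\<^sup>+ x. f x * indicator F x \<partial>count_space F)"
      using that by (intro nn_integral_count_space_eq) auto
    also have "\<dots> = sum f F"
      using that by (simp add: nn_integral_count_space_finite)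
    finally show ?thesis .
  qed
  define B where "B n = from_nat_into A ` {..n}" for n
  have B: "finite (B n)" "B n \<subseteq> A" for n
    using from_nat_into[OF False] by (auto simp: B_def)
  have "incseq B"
    by (auto simp: incseq_def B_def)
  have "(SUP n. f x * indicator (B n) x) = f x" if "x \<in> A" for x
  proof -
    obtain n where "x = from_nat_into A n"
      using from_nat_into_surj[OF assms \<open>x \<in> A\<close>] by metis
    then have "x \<in> B n"
      by (auto simp: B_def)
    then show ?thesis
      by (intro antisym SUP_least SUP_upper2[of n]) (auto split: split_indicator)
  qed
  then have "(\<integral>\<^sup>+ x. f x \<partial>count_space A) = (\<integral>\<^sup>+ x. (SUP n. f x * indicator (B n) x) \<partial>count_space A)"
    by (intro nn_integral_cong) auto
  also have "\<dots> = (SUP n. \<integral>\<^sup>+ x. f x * indicator (B n) x \<partial>count_space A)"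
    using \<open>incseq B\<close>
    by (intro nn_integral_monotone_convergence_SUP)
       (auto simp: incseq_def le_fun_def split: split_indicator)
  also have "\<dots> \<le> infsum f A"
    using B by (auto simp: fin infsum intro!: SUP_least SUP_upper)
  finally have "(\<integral>\<^sup>+ x. f x \<partial>count_space A) \<le> infsum f A" .
  moreover have "sum f F \<le> (\<integral>\<^sup>+ x. f x \<partial>count_space A)" if "finite F" "F \<subseteq> A" for F
    unfolding fin[OF that, symmetric] by (intro nn_integral_mono) (auto split: split_indicator)
  then have "infsum f A \<le> (\<integral>\<^sup>+ x. f x \<partial>count_space A)"
    by (auto simp: infsum intro!: SUP_least)
  ultimately show ?thesis
    by (rule antisym)
qed (simp add: nn_integral_count_space_finite)

lemma countable_mixing_support:
  assumes "mixing_fun Discrete g"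
  shows "countable (mixing_support g)"
  using assms summable_countable_real[of g UNIV]
  by (auto simp: mixing_support_def summable_on_def)

lemma nn_integral_mixing_support:
  assumes "mixing_fun Discrete g"
  shows "(\<integral>\<^sup>+ w. ennreal (g w) \<partial>count_space (mixing_support g)) = 1"
proof -
  let ?S = "mixing_support g"
  have nonneg: "g w \<ge> 0" for w
    using assms by simp
  have "(g has_sum 1) ?S"
    using assms by (subst has_sum_cong_neutral[where g = g and T = UNIV])
      (auto simp: mixing_support_def)
  then have *: "g summable_on ?S" "infsum g ?S = 1"
    by (auto simp: summable_on_def infsumI)
  have "(\<integral>\<^sup>+ w. ennreal (g w) \<partial>count_space ?S) = infsum (\<lambda>w. ennreal (g w)) ?S"
    by (rule nn_integral_count_space_eq_infsum[OF countable_mixing_support[OF assms]])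
  also have "\<dots> = (SUP F\<in>{F. finite F \<and> F \<subseteq> ?S}. \<Sum>w\<in>F. ennreal (g w))"
    by (rule nonneg_infsum_complete) simp
  also have "\<dots> = (SUP F\<in>{F. finite F \<and> F \<subseteq> ?S}. ennreal (sum g F))"
    by (simp add: sum_ennreal nonneg)
  also have "\<dots> = ennreal (infsum g ?S)"
    using * nonneg by (intro infsum_nonneg_is_SUPREMUM_ennreal[symmetric]) auto
  finally show ?thesis
    by (simp add: *)
qed

lemma distr_discrete_law:
  assumes "prob_space N" and g: "mixing_fun Discrete g" and law: "has_mixing_law Discrete N W g"
  shows "distr N borel W = distr (density (count_space (mixing_support g)) g) borel (\<lambda>w. w)"
proof (rule measure_eqI)
  interpret prob_space N by fact
  let ?S = "mixing_support g"
  have [measurable]: "W \<in> borel_measurable N"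
    using law by simp
  interpret Q: prob_space "distr N borel W"
    by (rule prob_space_distr) simp
  have S: "countable ?S"
    by (rule countable_mixing_support[OF g])
  have sets [measurable]: "B \<in> sets borel" if "B \<subseteq> ?S" for B
    using countable_subset[OF that S] by (rule sets.countable[rotated]) auto
  have single: "emeasure (distr N borel W) {w} = ennreal (g w)" for w
  proof -
    have "W -` {w} \<inter> space N = {\<omega> \<in> space N. W \<omega> = w}"
      by auto
    then show ?thesis
      using law by (simp add: emeasure_distr emeasure_eq_measure)
  qed
  have part: "emeasure (distr N borel W) B = (\<integral>\<^sup>+ w. ennreal (g w) \<partial>count_space B)"
    if "B \<subseteq> ?S" for B
    using countable_subset[OF that S]
    by (subst emeasure_countable_singleton) (auto simp: single)
  have "emeasure (distr N borel W) ?S = 1"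
    using part[of ?S] nn_integral_mixing_support[OF g] by simp
  then have AE: "AE w in distr N borel W. w \<in> ?S"
    by (intro Q.AE_prob_1) (simp add: Q.emeasure_eq_measure)
  fix A assume "A \<in> sets (distr N borel W)"
  then have A [measurable]: "A \<in> sets borel"
    by simp
  have "emeasure (distr N borel W) A = emeasure (distr N borel W) (A \<inter> ?S)"
    using AE sets[of "A \<inter> ?S"] by (intro emeasure_eq_AE) auto
  also have "\<dots> = (\<integral>\<^sup>+ w. ennreal (g w) \<partial>count_space (A \<inter> ?S))"
    by (rule part) auto
  also have "\<dots> = (\<integral>\<^sup>+ w. ennreal (g w) * indicator A w \<partial>count_space ?S)"
    by (subst (1 2) nn_integral_count_space_indicator)
       (auto intro!: nn_integral_cong split: split_indicator)
  also have "\<dots> = emeasure (distr (density (count_space ?S) g) borel (\<lambda>w. w)) A"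
    by (subst emeasure_distr)
       (auto simp: emeasure_density intro!: nn_integral_cong split: split_indicator)
  finally show "emeasure (distr N borel W) A =
    emeasure (distr (density (count_space ?S) g) borel (\<lambda>w. w)) A" .
qed simp

lemma distr_al_scale_mixture:
  fixes g :: "real \<Rightarrow> real"
  assumes "\<beta> > 0" and "\<kappa> > 0" and "prob_space N"
    and Y: "distributed N lborel Y (\<lambda>y. ennreal (al_pdf 0 1 \<kappa> y))"
    and indep: "prob_space.indep_var N borel Y borel W"
    and K: "sigma_finite_measure K" and meas_K [measurable]: "(\<lambda>w. w) \<in> measurable K borel"
    and meas_g [measurable]: "g \<in> borel_measurable K"
    and pos: "mixing_support g \<subseteq> {0<..}"
    and W: "distr N borel W = distr (density K g) borel (\<lambda>w. w)"
  shows "distr N borel (\<lambda>\<omega>. \<mu> + \<beta> * (Y \<omega> / W \<omega>)) =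
    density lborel (\<lambda>x. \<integral>\<^sup>+ w. ennreal (al_pdf \<mu> (\<beta> / w) \<kappa> x * g w) \<partial>K)"
proof (rule measure_eqI)
  interpret prob_space N by fact
  interpret K: sigma_finite_measure K by fact
  interpret KL: pair_sigma_finite K lborel ..
  have [measurable]: "Y \<in> borel_measurable N" "W \<in> borel_measurable N"
    using indep_var_rv1[OF indep] indep_var_rv2[OF indep] by auto
  interpret PY: prob_space "distr N borel Y"
    by (rule prob_space_distr) simp
  interpret PW: prob_space "distr N borel W"
    by (rule prob_space_distr) simp
  interpret P: pair_sigma_finite "distr N borel Y" "distr N borel W" ..
  have dY: "distr N borel Y = density lborel (\<lambda>y. ennreal (al_pdf 0 1 \<kappa> y))"
    using distributed_distr_eq_density[OF Y] by (simp cong: distr_cong)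
  fix A assume "A \<in> sets (distr N borel (\<lambda>\<omega>. \<mu> + \<beta> * (Y \<omega> / W \<omega>)))"
  then have A [measurable]: "A \<in> sets borel"
    by simp
  let ?I = "indicator A :: real \<Rightarrow> ennreal"
  have joint: "distr N borel (\<lambda>\<omega>. \<mu> + \<beta> * (Y \<omega> / W \<omega>)) =
      distr (distr N borel Y \<Otimes>\<^sub>M distr N borel W) borel (\<lambda>(y, w). \<mu> + \<beta> * (y / w))"
    using indep by (simp add: indep_var_distribution_eq distr_distr comp_def)
  have inner: "ennreal (g w) * (\<integral>\<^sup>+ y. ennreal (al_pdf 0 1 \<kappa> y) * ?I (\<mu> + \<beta> * (y / w)) \<partial>lborel) =
      (\<integral>\<^sup>+ x. ennreal (al_pdf \<mu> (\<beta> / w) \<kappa> x * g w) * ?I x \<partial>lborel)" for w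
  proof (cases "g w = 0")
    case False
    then have w: "\<beta> / w > 0"
      using pos \<open>\<beta> > 0\<close> by (auto simp: mixing_support_def)
    have "(\<integral>\<^sup>+ y. ennreal (al_pdf 0 1 \<kappa> y) * ?I (\<mu> + \<beta> * (y / w)) \<partial>lborel) =
        (\<integral>\<^sup>+ x. ennreal (al_pdf \<mu> (\<beta> / w) \<kappa> x) * ?I x \<partial>lborel)"
      using nn_integral_al_pdf_affine[of ?I "\<beta> / w" \<kappa> \<mu>] w by simp
    moreover have "ennreal (al_pdf \<mu> (\<beta> / w) \<kappa> x * g w) =
        ennreal (g w) * ennreal (al_pdf \<mu> (\<beta> / w) \<kappa> x)" for x
      using w \<open>\<kappa> > 0\<close> by (subst ennreal_mult') (auto intro: al_pdf_nonneg simp: mult.commute)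
    ultimately show ?thesis
      by (simp add: nn_integral_cmult[symmetric] mult.assoc)
  qed simp
  have "emeasure (distr N borel (\<lambda>\<omega>. \<mu> + \<beta> * (Y \<omega> / W \<omega>))) A =
      (\<integral>\<^sup>+ z. ?I z \<partial>distr N borel (\<lambda>\<omega>. \<mu> + \<beta> * (Y \<omega> / W \<omega>)))"
    by (simp add: nn_integral_indicator)
  also have "\<dots> = (\<integral>\<^sup>+ (y, w). ?I (\<mu> + \<beta> * (y / w)) \<partial>(distr N borel Y \<Otimes>\<^sub>M distr N borel W))"
    unfolding joint by (subst nn_integral_distr) (auto simp: case_prod_unfold)
  also have "\<dots> = (\<integral>\<^sup>+ w. \<integral>\<^sup>+ y. ?I (\<mu> + \<beta> * (y / w)) \<partial>distr N borel Y \<partial>distr N borel W)"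
    by (subst P.nn_integral_snd[symmetric]) auto
  also have "\<dots> = (\<integral>\<^sup>+ w. \<integral>\<^sup>+ y. ennreal (al_pdf 0 1 \<kappa> y) * ?I (\<mu> + \<beta> * (y / w)) \<partial>lborel
      \<partial>distr N borel W)"
    unfolding dY by (simp add: nn_integral_density)
  also have "\<dots> = (\<integral>\<^sup>+ w. ennreal (g w) *
      (\<integral>\<^sup>+ y. ennreal (al_pdf 0 1 \<kappa> y) * ?I (\<mu> + \<beta> * (y / w)) \<partial>lborel) \<partial>K)"
    unfolding W by (simp add: nn_integral_distr nn_integral_density)
  also have "\<dots> = (\<integral>\<^sup>+ w. \<integral>\<^sup>+ x. ennreal (al_pdf \<mu> (\<beta> / w) \<kappa> x * g w) * ?I x \<partial>lborel \<partial>K)"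
    by (simp only: inner)
  also have "\<dots> = (\<integral>\<^sup>+ x. \<integral>\<^sup>+ w. ennreal (al_pdf \<mu> (\<beta> / w) \<kappa> x * g w) * ?I x \<partial>K \<partial>lborel)"
    by (rule KL.Fubini'[symmetric]) measurable
  also have "\<dots> = emeasure (density lborel (\<lambda>x. \<integral>\<^sup>+ w. ennreal (al_pdf \<mu> (\<beta> / w) \<kappa> x * g w) \<partial>K)) A"
    by (simp add: emeasure_density nn_integral_multc)
  finally show "emeasure (distr N borel (\<lambda>\<omega>. \<mu> + \<beta> * (Y \<omega> / W \<omega>))) A =
    emeasure (density lborel (\<lambda>x. \<integral>\<^sup>+ w. ennreal (al_pdf \<mu> (\<beta> / w) \<kappa> x * g w) \<partial>K)) A" .
qed simp

theorem proposition2: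
  fixes \<mu> \<beta> \<kappa> :: real and \<theta> :: 'p and h :: "'p \<Rightarrow> real \<Rightarrow> real" and k :: mixing_kind
    and M :: "'a measure" and X :: "'a \<Rightarrow> real"
    and N :: "'b measure" and Y W :: "'b \<Rightarrow> real"
  assumes "\<beta> > 0" and "\<kappa> > 0"
    and "mixing_fun k (h \<theta>)" and "mixing_support (h \<theta>) \<subseteq> {0<..}"
    and "prob_space M" and "distributed M lborel X (alsm_pdf k h \<mu> \<beta> \<kappa> \<theta>)"
    and "prob_space N" and "distributed N lborel Y (\<lambda>y. ennreal (al_pdf 0 1 \<kappa> y))"
    and "has_mixing_law k N W (h \<theta>)"
    and "prob_space.indep_var N borel Y borel W"
  shows "distr M borel X = distr N borel (\<lambda>\<omega>. \<mu> + \<beta> * (Y \<omega> / W \<omega>))"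
proof -
  let ?g = "h \<theta>" and ?S = "mixing_support (h \<theta>)"
  note mixture = distr_al_scale_mixture[OF assms(1,2,7,8,10) _ _ _ assms(4), where \<mu> = \<mu>]
  have "distr M borel X = density lborel (alsm_pdf k h \<mu> \<beta> \<kappa> \<theta>)"
    using distributed_distr_eq_density[OF assms(6)] by (simp cong: distr_cong)
  also have "\<dots> = distr N borel (\<lambda>\<omega>. \<mu> + \<beta> * (Y \<omega> / W \<omega>))"
  proof (cases k)
    case Continuous
    have [measurable]: "?g \<in> borel_measurable borel"
      using assms(3) Continuous by simp
    have "distr N borel W = density lborel ?g"
      using distributed_distr_eq_density[of N lborel W] assms(9) Continuous
      by (simp cong: distr_cong)
    also have "\<dots> = distr (density lborel ?g) borel (\<lambda>w. w)"
      by (rule distr_id2[symmetric]) simp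
    finally have law: "distr N borel W = distr (density lborel ?g) borel (\<lambda>w. w)" .
    have "alsm_pdf k h \<mu> \<beta> \<kappa> \<theta> = (\<lambda>x. \<integral>\<^sup>+ w. ennreal (al_pdf \<mu> (\<beta> / w) \<kappa> x * ?g w) \<partial>lborel)"
      unfolding Continuous alsm_pdf.simps
      by (intro ext nn_integral_cong) (auto simp: mixing_support_def split: split_indicator)
    then show ?thesis
      using mixture[OF lborel.sigma_finite_measure_axioms _ _ law] by simp
  next
    case Discrete
    have g: "mixing_fun Discrete ?g"
      using assms(3) Discrete by simp
    note S = countable_mixing_support[OF g]
    have law: "distr N borel W = distr (density (count_space ?S) ?g) borel (\<lambda>w. w)"
      using assms(7,9) g Discrete by (intro distr_discrete_law) auto
    have "alsm_pdf k h \<mu> \<beta> \<kappa> \<theta> =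
        (\<lambda>x. \<integral>\<^sup>+ w. ennreal (al_pdf \<mu> (\<beta> / w) \<kappa> x * ?g w) \<partial>count_space ?S)"
      unfolding Discrete alsm_pdf.simps
      by (intro ext nn_integral_count_space_eq_infsum[symmetric] S)
    then show ?thesis
      using mixture[OF sigma_finite_measure_count_space_countable[OF S] _ _ law] by simp
  qed
  finally show ?thesis .
qed

end
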